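(* For any $d,a_0,\ldots,a_d\in\mathbb{N}_0$ and $c_1,\ldots,c_d\in\mathbb{N}\setminus\{2\}$ with $c_1\ge3$ if $a_0=0$ and $d\ge1$, putting $c_0=1$, $c_{d+1}=0$, $\delta_i=\delta(c_i)+\delta(c_{i+1})$, $k_{-1}=0$, $$t^{\star}(\{2\}^{a_0},c_1,\{2\}^{a_1},\ldots,c_d,\{2\}^{a_d})=\frac{2}{\pi}\sum_{k_0\geq k_1\geq\cdots\geq k_d\geq1}\prod_{i=0}^{d}\frac{(-1)^{k_i\delta_i}}{(2k_i-1)^{2a_i-\delta_i+3}}V_{k_{i-1},k_i}^{\#}(\{1\}^{c_i-3}).$$
   Context: For an index $\boldsymbol{s}=(s_1,\ldots,s_r)$ of positive integers with $s_1>1$ (or empty), $t^{\star}(\boldsymbol{s})=\sum_{k_1\geq\cdots\geq k_r\geq1}\prod_{j=1}^r(2k_j-1)^{-s_j}$, $t^\star(\emptyset)=1$. $\{s\}^a$ denotes $s$ repeated $a$ times; for $a\le0$, $\{1\}^a$ is empty. $\triangle(k,m)=0$ if $k=m$, $1$ otherwise. For an index $\boldsymbol{s}=(s_1,\ldots,s_r)$ and $k,m\in\mathbb{N}_0$: if $\boldsymbol{s}\ne\emptyset$ and $k\ge m$, $V^{\#}_{k,m}(\boldsymbol{s})=\frac{2k-1}{2m-1}\sum_{k\geq l_1\geq\cdots\geq l_r\geq m}\frac{2^{\triangle(k,l_1)+\triangle(l_1,l_2)+\cdots+\triangle(l_r,m)}}{(2l_1-1)^{s_1}\cdots(2l_r-1)^{s_r}}$;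 otherwise $V^{\#}_{k,m}(\boldsymbol{s})=\left(2\cdot\frac{2k-1}{2m-1}\right)^{\triangle(k,m)}$. $\delta(0)=2$, $\delta(1)=1$, $\delta(c)=0$ for $c\ge3$. *)

theory Defs
  imports "HOL-Analysis.Analysis"
begin

definition chains :: "nat \<Rightarrow> nat set \<Rightarrow> nat list set" where
  "chains r A = {ls. length ls = r \<and> sorted_wrt (\<ge>) ls \<and> set ls \<subseteq> A}"

definition t_star :: "nat list \<Rightarrow> real" where
  "t_star s = infsum (\<lambda>ks. \<Prod>j<length s. 1 / (2 * real (ks ! j) - 1) ^ (s ! j))
                     (chains (length s) {1..})"

definition tri :: "nat \<Rightarrow> nat \<Rightarrow> nat" where
  "tri k m = (if k = m then 0 else 1)"

fun tri_chain :: "nat list \<Rightarrow> nat" where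
  "tri_chain (x # y # rest) = tri x y + tri_chain (y # rest)"
| "tri_chain _ = 0"

definition Vsharp :: "nat \<Rightarrow> nat \<Rightarrow> nat list \<Rightarrow> real" where
  "Vsharp k m s =
    (if s \<noteq> [] \<and> k \<ge> m then
       (2 * real k - 1) / (2 * real m - 1) *
       (\<Sum>ls\<in>chains (length s) {m..k}.
          2 ^ tri_chain (k # ls @ [m]) / (\<Prod>j<length s. (2 * real (ls ! j) - 1) ^ (s ! j)))
     else (2 * ((2 * real k - 1) / (2 * real m - 1))) ^ tri k m)"

definition delta :: "nat \<Rightarrow> nat" where
  "delta c = (if c = 0 then 2 else if c = 1 then 1 else 0)"

definition cx :: "nat \<Rightarrow> (nat \<Rightarrow> nat) \<Rightarrow> nat \<Rightarrow> nat" where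
  "cx d c i = (if i = 0 then 1 else if i = d + 1 then 0 else c i)"

definition idx :: "nat \<Rightarrow> (nat \<Rightarrow> nat) \<Rightarrow> (nat \<Rightarrow> nat) \<Rightarrow> nat list" where
  "idx d a c = replicate (a 0) 2 @ concat (map (\<lambda>i. c i # replicate (a i) 2) [1..<d+1])"

end

theory Submission
  imports Defs "HOL-Real_Asymp.Real_Asymp"
begin

text \<open>
  Let A(n,k) be the coefficient of 1 / (1 - z^2 / (2 k - 1)^2) in the partial fraction expansion of the
  product of 1 / (1 - z^2 / (2 j - 1)^2) over 1 \<le> j \<le> n. As a lower triangular matrix, A intertwines the
  step ``weight by 1 / (2 m - 1)^c and sum over m \<le> n'' of the truncated star sums with a triangular
  operator K_c. The operator K_2 is diagonal with entries 1 / (2 k - 1)^2, K_1 has an alternating kernel,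
  and K_c for c \<ge> 3 is K_2 followed by c - 2 applications of the kernel with entries 1 / (2 k - 1) on the
  diagonal and 2 / (2 k - 1) below it; all this reduces to telescoping sums. Since A(n,1) + \<dots> + A(n,n) = 1,
  the star sum truncated at n is the sum of A(n,k) F(k) over k \<le> n, where F arises from the constant 1 by
  applying the K_c. By Wallis' product A(n,k) tends to 4 (-1)^(k+1) / (\<pi> (2 k - 1)), increasingly in
  absolute value, and for a nonempty admissible index F(k) is bounded by a constant times a power of the
  harmonic number H_k divided by 2 k - 1, so Tannery's theorem gives the limit. For the empty index the
  claim is Leibniz' series.
\<close>

section \<open>Partial fraction coefficients and summation kernels\<close>

definition odd_real :: "nat \<Rightarrow> real" where
  "odd_real k = 2 * real k - 1"

text \<open>The factorials come from (2 j - 1)^2 - (2 k - 1)^2 = 4 (j - k) (j + k - 1). With the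
  sign and 1 / (2 k - 1) split off, the ratio of the values at k + 1 and k is just (n - k) / (n +
  k). Meant for k <= n only, as \<open>n - k\<close> truncates.\<close>

definition pf_weight :: "nat \<Rightarrow> nat \<Rightarrow> real" where
  "pf_weight n k = 4 * (\<Prod>j=1..n. (odd_real j / 2)\<^sup>2) / (fact (n - k) * fact (n + k - 1))"

text \<open>For 1 \<le> k \<le> n this is the product of 1 / (1 - (2 k - 1)^2 / (2 j - 1)^2) over j \<noteq> k, 1 \<le> j \<le> n.\<close>

definition pf_coeff :: "nat \<Rightarrow> nat \<Rightarrow> real" where
  "pf_coeff n k = (-1) ^ (k + 1) * pf_weight n k / odd_real k"

definition pf_sum :: "(nat \<Rightarrow> real) \<Rightarrow> nat \<Rightarrow> real" where
  "pf_sum f n = (\<Sum>k=1..n. pf_coeff n k * f k)"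

text \<open>By \<open>pf_sum_Suc_left\<close> this is, for n >= 1, (2 n - 1)^2 times the backward
  difference of \<open>pf_sum f\<close> at n.\<close>

definition pf_diff :: "(nat \<Rightarrow> real) \<Rightarrow> nat \<Rightarrow> real" where
  "pf_diff f n = pf_sum (\<lambda>k. (odd_real k)\<^sup>2 * f k) n"

definition half_sum :: "(nat \<Rightarrow> real) \<Rightarrow> nat \<Rightarrow> real" where
  "half_sum f k = (\<Sum>j=1..k. 2 ^ tri k j * f j) / odd_real k"

definition alt_sum :: "(nat \<Rightarrow> real) \<Rightarrow> nat \<Rightarrow> real" where
  "alt_sum f k = (\<Sum>j=1..k. (-1) ^ (k + j) * 2 ^ tri k j * f j / odd_real j)"

text \<open>Parity. The case k = 0, with value -1, is covered, so divisions cancel without side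
  conditions.\<close>

lemma odd_real_nonzero [simp]: "odd_real k \<noteq> 0"
proof
  assume "odd_real k = 0"
  then have "real (2 * k) = real 1" by (simp add: odd_real_def)
  then show False by (simp only: of_nat_eq_iff) presburger
qed

lemma odd_real_ge: "1 \<le> k \<Longrightarrow> real k \<le> odd_real k"
  by (simp add: odd_real_def)

lemma odd_real_ge_1: "1 \<le> k \<Longrightarrow> 1 \<le> odd_real k"
  by (simp add: odd_real_def)

lemma odd_real_pos: "1 \<le> k \<Longrightarrow> 0 < odd_real k"
  by (simp add: odd_real_def)

section \<open>Recurrences of the weights and telescoping sums\<close>

lemma pf_weight_nonneg: "0 \<le> pf_weight n k"
  by (simp add: pf_weight_def prod_nonneg)

text \<open>Going to k + 1 takes n - k out of the first factorial and puts n + k into the second.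
  The case k = 0 is included, so that the sums below can start at k = 1.\<close>

lemma pf_weight_Suc_right:
  assumes "k < n"
  shows "pf_weight n k * (real n - real k) = pf_weight n (Suc k) * (real n + real k)"
proof -
  obtain m where m: "n = Suc (k + m)" using assms less_iff_Suc_add by blast
  define P where "P = (\<Prod>j=1..n. (odd_real j / 2)\<^sup>2)"
  have "pf_weight n k = 4 * P / (((real n - real k) * fact m) * fact (n + k - 1))"
    unfolding pf_weight_def P_def by (simp add: m)
  moreover have "pf_weight n (Suc k) = 4 * P / (fact m * ((real n + real k) * fact (n + k - 1)))"
    unfolding pf_weight_def P_def by (simp add: m)
  moreover have "4 * P / ((u * f) * h) * u = 4 * P / (f * (v * h)) * v" if "u \<noteq> 0" "v \<noteq> 0" for u v f h :: real
    using that by (simp add: field_simps)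
  moreover have "real n - real k \<noteq> 0" "real n + real k \<noteq> 0" using assms by auto
  ultimately show ?thesis by simp
qed

text \<open>Going to n + 1 multiplies the partial fraction product by its factor with j = n +
  1.\<close>

lemma pf_weight_Suc_left:
  assumes "1 \<le> k" "k \<le> n"
  shows "pf_weight (Suc n) k * ((odd_real (Suc n))\<^sup>2 - (odd_real k)\<^sup>2)
         = pf_weight n k * (odd_real (Suc n))\<^sup>2"
proof -
  obtain m where m: "n = k + m" using assms le_iff_add by blast
  obtain l where l: "k = Suc l" using assms by (cases k) auto
  have p: "(odd_real (Suc n))\<^sup>2 - (odd_real k)\<^sup>2 = 4 * (1 + real m) * (real n + real k)"
    by (simp add: odd_real_def m power2_eq_square algebra_simps)
  define P where "P = (\<Prod>j=1..n. (odd_real j / 2)\<^sup>2)"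
  have w1: "pf_weight (Suc n) k
      = 4 * (P * (odd_real (Suc n) / 2)\<^sup>2) / (((1 + real m) * fact m) * ((real n + real k) * fact (n + l)))"
    unfolding pf_weight_def P_def by (simp add: m l Suc_diff_le algebra_simps)
  have w0: "pf_weight n k = 4 * P / (fact m * fact (n + l))"
    unfolding pf_weight_def P_def by (simp add: m l)
  have "4 * (P * (q / 2)\<^sup>2) / ((u * f) * (v * h)) * (4 * u * v) = 4 * P / (f * h) * q\<^sup>2"
    if "u \<noteq> 0" "v \<noteq> 0" for u v f h q :: real
    using that by (simp add: field_simps power2_eq_square)
  moreover have "real n + real k \<noteq> 0" "1 + real m \<noteq> 0" using assms by auto
  ultimately show ?thesis unfolding p w1 w0 by blast
qed

text \<open>The k-th summand is T(k - 1) - T(k) with T(k) = (n - k) \<open>pf_weight n k\<close>, by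
  \<open>pf_weight_Suc_right\<close>; T(n) = 0.\<close>

lemma sum_odd_pf_weight:
  assumes "j \<le> n"
  shows "(\<Sum>k=Suc j..n. odd_real k * pf_weight n k) = pf_weight n j * (real n - real j)"
  using assms
proof (induction j rule: inc_induct)
  case base
  show ?case by simp
next
  case (step j)
  have "(\<Sum>k=Suc j..n. odd_real k * pf_weight n k)
      = odd_real (Suc j) * pf_weight n (Suc j) + pf_weight n (Suc j) * (real n - real (Suc j))"
    using step by (subst sum.atLeast_Suc_atMost) auto
  also have "\<dots> = pf_weight n (Suc j) * (real n + real j)"
    by (simp add: odd_real_def algebra_simps)
  finally show ?case using pf_weight_Suc_right[of j n] step by simp
qed

text \<open>The closed form is the antidifference found by Gosper's algorithm.\<close>

lemma sum_alternating_odd_pf_weight: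
  assumes "j \<le> n" "2 \<le> n"
  shows "(\<Sum>k=Suc j..n. (-1) ^ k * odd_real k * pf_weight n k)
         = - ((-1) ^ j * real j * (real n - real j) * pf_weight n j / (real n - 1))"
  using assms(1)
proof (induction j rule: inc_induct)
  case base
  show ?case by simp
next
  case (step j)
  have n: "real n - 1 \<noteq> 0" using assms by simp
  have "(\<Sum>k=Suc j..n. (-1) ^ k * odd_real k * pf_weight n k)
      = (-1) ^ Suc j * odd_real (Suc j) * pf_weight n (Suc j)
        - ((-1) ^ Suc j * real (Suc j) * (real n - real (Suc j)) * pf_weight n (Suc j) / (real n - 1))"
    using step by (subst sum.atLeast_Suc_atMost) auto
  also have "\<dots> = - ((-1) ^ j * real j * (pf_weight n (Suc j) * (real n + real j)) / (real n - 1))"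
    using n by (simp add: odd_real_def field_simps)
  finally show ?case using pf_weight_Suc_right[of j n] step by (simp add: mult_ac)
qed

text \<open>The left side is the factor of f j in \<open>pf_diff (half_sum f) n\<close> after
  interchanging the sums. Between j and j + 1 it changes by a difference of neighbouring weights, up
  to sign.\<close>

lemma sum_pf_coeff_tail:
  assumes "1 \<le> j" "j \<le> n"
  shows "pf_coeff n j * odd_real j + 2 * (\<Sum>k=Suc j..n. pf_coeff n k * odd_real k)
         = pf_coeff n j * (odd_real j)\<^sup>2 / odd_real n"
  using assms(2)
proof (induction j rule: inc_induct)
  case base
  show ?case by (simp add: power2_eq_square)
next
  case (step j)
  have *: "pf_coeff n i * odd_real i = (-1) ^ (i + 1) * pf_weight n i" for i
    by (simp add: pf_coeff_def)
  have sq: "pf_coeff n i * (odd_real i)\<^sup>2 = (-1) ^ (i + 1) * pf_weight n i * odd_real i" for i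
    by (simp add: pf_coeff_def power2_eq_square)
  have "pf_coeff n j * odd_real j + 2 * (\<Sum>k=Suc j..n. pf_coeff n k * odd_real k)
     = pf_coeff n j * odd_real j + pf_coeff n (Suc j) * odd_real (Suc j)
       + pf_coeff n (Suc j) * (odd_real (Suc j))\<^sup>2 / odd_real n"
    using step by (subst sum.atLeast_Suc_atMost) (auto simp: algebra_simps)
  also have "\<dots> = (-1) ^ (j + 1) * (pf_weight n j - pf_weight n (Suc j) * (1 + odd_real (Suc j) / odd_real n))"
    unfolding * sq by (simp add: algebra_simps)
  also have "pf_weight n (Suc j) * (1 + odd_real (Suc j) / odd_real n)
           = 2 * (pf_weight n (Suc j) * (real n + real j)) / odd_real n"
    by (simp add: field_simps) (simp add: odd_real_def algebra_simps)
  also have "\<dots> = 2 * (pf_weight n j * (real n - real j)) / odd_real n"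
    using pf_weight_Suc_right[of j n] step by simp
  also have "pf_weight n j - 2 * (pf_weight n j * (real n - real j)) / odd_real n
           = pf_weight n j * odd_real j / odd_real n"
    by (simp add: field_simps) (simp add: odd_real_def algebra_simps)
  finally show ?case unfolding sq by (simp add: mult_ac)
qed

lemma pf_coeff_Suc_left:
  assumes "1 \<le> k" "k \<le> n"
  shows "pf_coeff (Suc n) k - pf_coeff n k
         = pf_coeff (Suc n) k * (odd_real k)\<^sup>2 / (odd_real (Suc n))\<^sup>2"
proof -
  have "pf_weight n k = pf_weight (Suc n) k * ((odd_real (Suc n))\<^sup>2 - (odd_real k)\<^sup>2) / (odd_real (Suc n))\<^sup>2"
    using pf_weight_Suc_left[OF assms] by (simp add: field_simps)
  then have "pf_weight (Suc n) k - pf_weight n k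
      = pf_weight (Suc n) k * (odd_real k)\<^sup>2 / (odd_real (Suc n))\<^sup>2"
    by (simp add: field_simps)
  then have "(-1) ^ (k + 1) / odd_real k * (pf_weight (Suc n) k - pf_weight n k)
      = (-1) ^ (k + 1) / odd_real k
        * (pf_weight (Suc n) k * (odd_real k)\<^sup>2 / (odd_real (Suc n))\<^sup>2)"
    by (rule arg_cong)
  then show ?thesis
    unfolding pf_coeff_def by (simp add: diff_divide_distrib right_diff_distrib)
qed

section \<open>The transform, its intertwining relations and truncated star sums\<close>

text \<open>For k <= n the coefficient differences are those of \<open>pf_coeff_Suc_left\<close>; in
  the new column k = n + 1 the square cancels against the denominator.\<close>

lemma pf_sum_Suc_left:
  "pf_sum f (Suc n) = pf_sum f n + pf_diff f (Suc n) / (odd_real (Suc n))\<^sup>2"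
proof -
  have "pf_diff f (Suc n) / (odd_real (Suc n))\<^sup>2
      = (\<Sum>k=1..n. pf_coeff (Suc n) k * (odd_real k)\<^sup>2 / (odd_real (Suc n))\<^sup>2 * f k)
        + pf_coeff (Suc n) (Suc n) * f (Suc n)"
    by (simp add: pf_diff_def pf_sum_def add_divide_distrib sum_divide_distrib mult_ac)
  also have "(\<Sum>k=1..n. pf_coeff (Suc n) k * (odd_real k)\<^sup>2 / (odd_real (Suc n))\<^sup>2 * f k)
      = (\<Sum>k=1..n. pf_coeff (Suc n) k * f k) - pf_sum f n"
    unfolding pf_sum_def sum_subtractf[symmetric]
    by (intro sum.cong refl) (simp add: pf_coeff_Suc_left[symmetric] algebra_simps)
  finally show ?thesis by (simp add: pf_sum_def)
qed

text \<open>Summed differences. Hence \<open>pf_diff\<close> of a function determines which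
  summation step its transform performs.\<close>

lemma pf_sum_eq_sum_pf_diff:
  "pf_sum f n = (\<Sum>m=1..n. pf_diff f m / (odd_real m)\<^sup>2)"
  by (induction n) (simp add: pf_sum_def, simp add: pf_sum_Suc_left)

lemma pf_diff_divide_square: "pf_diff (\<lambda>k. f k / (odd_real k)\<^sup>2) n = pf_sum f n"
  by (simp add: pf_diff_def)

lemma sum_triangle_swap:
  fixes f :: "nat \<Rightarrow> nat \<Rightarrow> real"
  shows "(\<Sum>k=1..n. \<Sum>j=1..k. f k j) = (\<Sum>j=1..n. \<Sum>k=j..n. f k j)"
  unfolding sum.Sigma[OF finite_atLeastAtMost ballI[OF finite_atLeastAtMost]]
  by (rule sum.reindex_bij_witness[of _ prod.swap prod.swap]) force+

lemma sum_triangle_swap_diagonal: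
  fixes f :: "nat \<Rightarrow> nat \<Rightarrow> real"
  shows "(\<Sum>k=1..n. \<Sum>j=1..k. f k j) = (\<Sum>j=1..n. f j j + (\<Sum>k=Suc j..n. f k j))"
  unfolding sum_triangle_swap by (intro sum.cong refl sum.atLeast_Suc_atMost) simp

text \<open>Each \<open>half_sum\<close> raises the exponent of 1 / (2 n - 1) by one, which is why
  an entry c >= 3 needs c - 2 of them on top of the diagonal K_2.\<close>

lemma pf_diff_half_sum: "pf_diff (half_sum f) n = pf_diff f n / odd_real n"
proof -
  have "pf_diff (half_sum f) n
      = (\<Sum>k=1..n. \<Sum>j=1..k. pf_coeff n k * odd_real k * 2 ^ tri k j * f j)"
    unfolding pf_diff_def pf_sum_def
  proof (intro sum.cong refl)
    fix k
    have "(odd_real k)\<^sup>2 * half_sum f k = odd_real k * (\<Sum>j=1..k. 2 ^ tri k j * f j)"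
      by (simp add: half_sum_def power2_eq_square)
    then show "pf_coeff n k * ((odd_real k)\<^sup>2 * half_sum f k)
        = (\<Sum>j=1..k. pf_coeff n k * odd_real k * 2 ^ tri k j * f j)"
      by (simp add: sum_distrib_left mult_ac)
  qed
  also have "\<dots> = (\<Sum>j=1..n. (pf_coeff n j * odd_real j
                     + 2 * (\<Sum>k=Suc j..n. pf_coeff n k * odd_real k)) * f j)"
    unfolding sum_triangle_swap_diagonal
    by (intro sum.cong refl) (simp add: tri_def sum_distrib_left sum_distrib_right algebra_simps)
  also have "\<dots> = (\<Sum>j=1..n. pf_coeff n j * (odd_real j)\<^sup>2 / odd_real n * f j)"
    by (intro sum.cong refl) (simp add: sum_pf_coeff_tail)
  finally show ?thesis by (simp add: pf_diff_def pf_sum_def sum_divide_distrib mult_ac)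
qed

lemma pf_diff_half_sum_funpow: "pf_diff ((half_sum ^^ r) f) n = pf_diff f n / odd_real n ^ r"
  by (induction r) (simp_all add: pf_diff_half_sum)

text \<open>The signs of \<open>alt_sum\<close> and \<open>pf_coeff\<close> cancel, leaving column
  sums of positive weights as in \<open>sum_odd_pf_weight\<close>. The factor
  \<open>odd_real n\<close> reduces the square in \<open>pf_sum_eq_sum_pf_diff\<close> to the
  exponent 1.\<close>

lemma pf_diff_alt_sum: "pf_diff (alt_sum f) n = odd_real n * pf_sum f n"
proof -
  have "pf_diff (alt_sum f) n
      = (\<Sum>k=1..n. \<Sum>j=1..k. pf_coeff n k * (odd_real k)\<^sup>2 * ((-1) ^ (k + j) * 2 ^ tri k j * f j / odd_real j))"
    by (simp add: pf_diff_def pf_sum_def alt_sum_def sum_distrib_left mult_ac)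
  also have "\<dots> = (\<Sum>k=1..n. \<Sum>j=1..k. odd_real k * pf_weight n k * ((-1) ^ (j + 1) * 2 ^ tri k j * f j / odd_real j))"
    by (intro sum.cong refl) (simp add: pf_coeff_def power2_eq_square power_add field_simps)
  also have "\<dots> = (\<Sum>j=1..n. (odd_real j * pf_weight n j
                     + 2 * (\<Sum>k=Suc j..n. odd_real k * pf_weight n k)) * ((-1) ^ (j + 1) * f j / odd_real j))"
    unfolding sum_triangle_swap_diagonal
    by (intro sum.cong refl) (simp add: tri_def sum_distrib_left sum_distrib_right algebra_simps)
  also have "\<dots> = (\<Sum>j=1..n. odd_real n * (pf_coeff n j * f j))"
  proof (intro sum.cong refl)
    fix j assume "j \<in> {1..n}"
    then have "odd_real j * pf_weight n j + 2 * (\<Sum>k=Suc j..n. odd_real k * pf_weight n k)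
        = odd_real n * pf_weight n j"
      by (subst sum_odd_pf_weight) (auto simp: odd_real_def algebra_simps)
    then show "(odd_real j * pf_weight n j + 2 * (\<Sum>k=Suc j..n. odd_real k * pf_weight n k))
          * ((-1) ^ (j + 1) * f j / odd_real j) = odd_real n * (pf_coeff n j * f j)"
      by (simp only:) (simp add: pf_coeff_def)
  qed
  finally show ?thesis by (simp add: pf_sum_def sum_distrib_left)
qed

text \<open>The closed form of the alternating sum has the factor j, which is 0 here. For n = 1 the
  value would be 1.\<close>

lemma pf_diff_one:
  assumes "2 \<le> n"
  shows "pf_diff (\<lambda>_. 1) n = 0"
proof -
  have "pf_diff (\<lambda>_. 1) n = - (\<Sum>k=Suc 0..n. (-1) ^ k * odd_real k * pf_weight n k)"
    unfolding pf_diff_def pf_sum_def sum_negf[symmetric]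
    by (intro sum.cong) (auto simp: pf_coeff_def power2_eq_square)
  also have "\<dots> = 0"
    using assms by (subst sum_alternating_odd_pf_weight) auto
  finally show ?thesis .
qed

text \<open>The partial fraction expansion at z = 0; the sum is constant in n since its differences
  vanish.\<close>

lemma pf_sum_one:
  assumes "1 \<le> n"
  shows "pf_sum (\<lambda>_. 1) n = 1"
  using assms
proof (induction n rule: dec_induct)
  case base
  show ?case by (simp add: pf_sum_def pf_coeff_def pf_weight_def odd_real_def power2_eq_square)
next
  case (step n)
  then show ?case by (simp add: pf_sum_Suc_left pf_diff_one)
qed

text \<open>The function F of the introduction; the entries of the index are meant to be positive.\<close>

fun star_dual :: "nat list \<Rightarrow> nat \<Rightarrow> real" where
  "star_dual [] = (\<lambda>_. 1)"
| "star_dual (c # s) =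
     (if c = 1 then alt_sum (star_dual s)
      else (half_sum ^^ (c - 2)) (\<lambda>j. star_dual s j / (odd_real j)\<^sup>2))"

fun t_trunc :: "nat list \<Rightarrow> nat \<Rightarrow> real" where
  "t_trunc [] n = 1"
| "t_trunc (c # s) n = (\<Sum>m=1..n. t_trunc s m / odd_real m ^ c)"

text \<open>Up to 1 / (2 k - 1) this is the kernel of \<open>half_sum ^^ Suc r\<close>, and up to (2
  k - 1) / (2 m - 1) it is V for r ones; it links the two.\<close>

fun half_kernel :: "nat \<Rightarrow> nat \<Rightarrow> nat \<Rightarrow> real" where
  "half_kernel 0 k m = 2 ^ tri k m"
| "half_kernel (Suc r) k m = (\<Sum>l=m..k. 2 ^ tri k l / odd_real l * half_kernel r l m)"

text \<open>Both sides are sums over m <= n, and the intertwining relations identify the m-th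
  terms.\<close>

lemma t_trunc_eq_pf_sum:
  assumes "\<forall>c\<in>set s. 1 \<le> c" "1 \<le> n"
  shows "t_trunc s n = pf_sum (star_dual s) n"
  using assms
proof (induction s arbitrary: n)
  case Nil
  then show ?case by (simp add: pf_sum_one)
next
  case (Cons c s)
  have "pf_diff (star_dual (c # s)) m / (odd_real m)\<^sup>2 = t_trunc s m / odd_real m ^ c"
    if "m \<in> {1..n}" for m
  proof (cases "c = 1")
    case True
    then show ?thesis using Cons that by (simp add: pf_diff_alt_sum power2_eq_square)
  next
    case False
    then have c: "c = c - 2 + 2" using Cons.prems by auto
    have "odd_real m ^ c = odd_real m ^ (c - 2) * (odd_real m)\<^sup>2"
      by (subst c) (rule power_add)
    then show ?thesis
      using False Cons that by (simp add: pf_diff_half_sum_funpow pf_diff_divide_square)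
  qed
  then show ?case unfolding pf_sum_eq_sum_pf_diff by simp
qed

section \<open>Sums over chains and the kernels V\<close>

lemma finite_chains: "finite A \<Longrightarrow> finite (chains r A)"
  by (rule finite_subset[OF _ finite_lists_length_eq[of A r]]) (auto simp: chains_def)

lemma chains_0: "chains 0 A = {[]}"
  by (auto simp: chains_def)

text \<open>Splits off the head, the largest entry. The lower end l is general because star sums
  start at 1 and V starts at m.\<close>

lemma sum_chains_Suc:
  fixes f :: "nat list \<Rightarrow> real"
  shows "(\<Sum>ks\<in>chains (Suc r) {l..n}. f ks) = (\<Sum>m=l..n. \<Sum>ks\<in>chains r {l..m}. f (m # ks))"
proof -
  have eq: "chains (Suc r) {l..n} = (\<lambda>(m, ks). m # ks) ` Sigma {l..n} (\<lambda>m. chains r {l..m})"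
    (is "?A = ?B")
  proof
    show "?A \<subseteq> ?B"
    proof
      fix ks assume ks: "ks \<in> ?A"
      then obtain m ms where "ks = m # ms" by (cases ks) (auto simp: chains_def)
      then show "ks \<in> ?B" using ks
        by (intro image_eqI[of _ _ "(m, ms)"]) (auto simp: chains_def)
    qed
    show "?B \<subseteq> ?A" by (fastforce simp: chains_def)
  qed
  have "inj_on (\<lambda>(m, ks). m # ks) (Sigma {l..n} (\<lambda>m. chains r {l..m}))"
    by (auto simp: inj_on_def)
  then show ?thesis
    unfolding eq by (subst sum.reindex) (simp_all add: sum.Sigma finite_chains case_prod_beta)
qed

lemma sum_chains_eq_t_trunc:
  "(\<Sum>ks\<in>chains (length s) {1..n}. \<Prod>j<length s. 1 / (2 * real (ks ! j) - 1) ^ (s ! j)) = t_trunc s n"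
proof (induction s arbitrary: n)
  case Nil
  then show ?case by (simp add: chains_0)
next
  case (Cons c s)
  show ?case
    unfolding length_Cons sum_chains_Suc prod.lessThan_Suc_shift t_trunc.simps Cons.IH[symmetric]
    by (simp add: odd_real_def sum_divide_distrib)
qed

lemma sum_chains_eq_half_kernel:
  "(\<Sum>ls\<in>chains r {m..k}. 2 ^ tri_chain (k # ls @ [m]) / (\<Prod>j<r. odd_real (ls ! j))) = half_kernel r k m"
proof (induction r arbitrary: k)
  case 0
  then show ?case by (simp add: chains_0)
next
  case (Suc r)
  show ?case
    unfolding sum_chains_Suc prod.lessThan_Suc_shift half_kernel.simps Suc.IH[symmetric]
    by (simp add: power_add sum_distrib_left mult_ac)
qed

text \<open>For r = 0 the other branch of \<open>Vsharp\<close> applies; it agrees because the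
  quotient is 1 when k = m and so may leave the power.\<close>

lemma Vsharp_replicate_1:
  assumes "m \<le> k"
  shows "Vsharp k m (replicate r 1) = odd_real k / odd_real m * half_kernel r k m"
proof (cases r)
  case 0
  then show ?thesis using assms
    by (simp add: Vsharp_def tri_def flip: odd_real_def)
next
  case (Suc q)
  have "(\<Prod>j<r. odd_real (ls ! j) ^ (replicate r 1 ! j)) = (\<Prod>j<r. odd_real (ls ! j))" for ls
    by (intro prod.cong) auto
  then show ?thesis
    using assms Suc sum_chains_eq_half_kernel[where r = r]
    by (simp add: Vsharp_def del: half_kernel.simps replicate.simps flip: odd_real_def)
qed

lemma half_sum_funpow_Suc:
  "(half_sum ^^ Suc r) f k = (\<Sum>j=1..k. half_kernel r k j * f j) / odd_real k"
proof (induction r arbitrary: k)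
  case 0
  then show ?case by (simp add: half_sum_def)
next
  case (Suc r)
  have "(half_sum ^^ Suc (Suc r)) f k
      = (\<Sum>l=1..k. \<Sum>j=1..l. 2 ^ tri k l / odd_real l * half_kernel r l j * f j) / odd_real k"
    by (subst funpow.simps, subst o_apply, subst half_sum_def, subst Suc.IH)
       (simp add: sum_distrib_left sum_divide_distrib mult_ac)
  then show ?case
    unfolding sum_triangle_swap by (simp add: sum_distrib_right)
qed

text \<open>One formula for c = 1 and c >= 3. For c = 1 the sign (-1)^(k + q) factors into a part at
  k and a part at q, and \<open>c - 3\<close> truncates to 0 as the empty index requires.\<close>

lemma star_dual_Cons_eq_Vsharp:
  assumes "1 \<le> c" "c \<noteq> 2"
  shows "star_dual (c # s) k = (-1) ^ (k * delta c) / odd_real k ^ (2 - delta c)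
    * (\<Sum>q=1..k. Vsharp k q (replicate (c - 3) 1)
         * ((-1) ^ (q * delta c) / odd_real q ^ (1 - delta c) * star_dual s q))"
proof -
  have V: "Vsharp k q (replicate r 1) = odd_real k / odd_real q * half_kernel r k q"
    if "q \<in> {1..k}" for q r
    using that by (intro Vsharp_replicate_1) simp
  show ?thesis
  proof (cases "c = 1")
    case True
    then have "star_dual (c # s) k = alt_sum (star_dual s) k" by simp
    also have "\<dots> = (-1) ^ (k * delta c) / odd_real k ^ (2 - delta c)
      * (\<Sum>q=1..k. odd_real k / odd_real q * half_kernel (c - 3) k q
         * ((-1) ^ (q * delta c) / odd_real q ^ (1 - delta c) * star_dual s q))"
      using True unfolding alt_sum_def sum_distrib_left
      by (intro sum.cong) (auto simp: delta_def power_add)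
    finally show ?thesis using V by simp
  next
    case False
    define r where "r = c - 3"
    with False assms have r: "c = r + 3" by simp
    then have "c - 2 = Suc r" by simp
    then have "star_dual (c # s) k
        = (\<Sum>j=1..k. half_kernel r k j * (star_dual s j / (odd_real j)\<^sup>2)) / odd_real k"
      using False by (simp only: star_dual.simps if_False half_sum_funpow_Suc)
    also have "\<dots> = (-1) ^ (k * delta c) / odd_real k ^ (2 - delta c)
      * (\<Sum>q=1..k. odd_real k / odd_real q * half_kernel (c - 3) k q
         * ((-1) ^ (q * delta c) / odd_real q ^ (1 - delta c) * star_dual s q))"
      using r unfolding sum_divide_distrib sum_distrib_left
      by (intro sum.cong) (auto simp: delta_def power2_eq_square)
    finally show ?thesis using V by simp
  qed
qed

lemma star_dual_replicate_2:
  "star_dual (replicate b 2 @ s) k = star_dual s k / odd_real k ^ (2 * b)"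
  by (induction b) (simp_all add: power2_eq_square)

section \<open>The dual function of the index as a nested sum\<close>

text \<open>The predecessor p is kept apart from the bound n: outermost they are k_{-1} = 0 and N,
  further in they coincide.\<close>

fun chain_sum :: "nat \<Rightarrow> (nat \<Rightarrow> nat \<Rightarrow> nat \<Rightarrow> real) \<Rightarrow> nat \<Rightarrow> nat \<Rightarrow> real" where
  "chain_sum 0 h p n = 1"
| "chain_sum (Suc r) h p n = (\<Sum>k=1..n. h 0 p k * chain_sum r (\<lambda>i. h (Suc i)) k k)"

lemma sum_chains_eq_chain_sum:
  "(\<Sum>ks\<in>chains r {1..n}. \<Prod>i<r. h i ((p # ks) ! i) (ks ! i)) = chain_sum r h p n"
proof (induction r arbitrary: h p n)
  case 0
  then show ?case by (simp add: chains_0)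
next
  case (Suc r)
  show ?case
    unfolding sum_chains_Suc prod.lessThan_Suc_shift chain_sum.simps Suc.IH[symmetric]
    by (simp add: sum_distrib_left)
qed

text \<open>The i-th factor of the theorem, with b = a_i, c = c_i, c' = c_{i+1}, p = k_{i-1} and q =
  k_i.\<close>

definition summand :: "nat \<Rightarrow> nat \<Rightarrow> nat \<Rightarrow> nat \<Rightarrow> nat \<Rightarrow> real" where
  "summand b c c' p q = (-1) ^ (q * (delta c + delta c')) / odd_real q ^ (2 * b + 3 - (delta c + delta c'))
     * Vsharp p q (replicate (c - 3) 1)"

lemma idx_Suc:
  "idx (Suc d) a c = replicate (a 0) 2 @ c 1 # idx d (\<lambda>i. a (Suc i)) (\<lambda>i. c (Suc i))"
proof -
  have "[1..<Suc d + 1] = 1 # map Suc [1..<d + 1]"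
    by (simp add: map_Suc_upt upt_conv_Cons del: upt_Suc)
  then show ?thesis by (simp add: idx_def o_def del: upt_Suc)
qed

lemma cx_Suc_Suc: "cx (Suc d) c (Suc (Suc i)) = cx d (\<lambda>i. c (Suc i)) (Suc i)"
  by (simp add: cx_def)

lemma delta_le_2: "delta c \<le> 2"
  by (simp add: delta_def)

lemma delta_le_1: "1 \<le> c \<Longrightarrow> delta c \<le> 1"
  by (simp add: delta_def)

text \<open>Separates the share of c, which closes the step from p to q, from the share of c', which
  opens the next step. Since \<open>delta c\<close> <= 1, no subtraction truncates.\<close>

lemma summand_split:
  assumes "1 \<le> c"
  shows "summand b c c' p q = Vsharp p q (replicate (c - 3) 1)
     * ((-1) ^ (q * delta c) / odd_real q ^ (1 - delta c)
        * ((-1) ^ (q * delta c') / odd_real q ^ (2 * b + 2 - delta c')))"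
proof -
  have "2 * b + 3 - (delta c + delta c') = (1 - delta c) + (2 * b + 2 - delta c')"
    using delta_le_1[OF assms] delta_le_2[of c'] by linarith
  then show ?thesis
    by (simp add: summand_def power_add distrib_left)
qed

lemma star_dual_idx:
  assumes "\<forall>i\<in>{1..d}. c i \<ge> 1 \<and> c i \<noteq> 2"
  shows "star_dual (idx d a c) k
    = (-1) ^ (k * delta (cx d c 1)) / odd_real k ^ (2 * a 0 + 2 - delta (cx d c 1))
      * chain_sum d (\<lambda>i. summand (a (Suc i)) (cx d c (Suc i)) (cx d c (Suc (Suc i)))) k k"
  using assms
proof (induction d arbitrary: a c k)
  \<comment> \<open>Here c_{d+1} = 0 has delta 2, which makes the sign trivial and the exponent 2
    a_0.\<close>
  case 0
  then show ?case
    using star_dual_replicate_2[of "a 0" "[]" k] by (simp add: idx_def cx_def delta_def)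
next
  case (Suc d)
  define a' c' where "a' = (\<lambda>i. a (Suc i))" and "c' = (\<lambda>i. c (Suc i))"
  have c1: "1 \<le> c 1" "c 1 \<noteq> 2" using Suc.prems by auto
  have cx1: "cx (Suc d) c (Suc 0) = c 1" by (simp add: cx_def)
  have "\<forall>i\<in>{1..d}. c' i \<ge> 1 \<and> c' i \<noteq> 2" using Suc.prems by (auto simp: c'_def)
  note IH = Suc.IH[OF this, of a']
  have e: "2 * a 0 + 2 - delta (c 1) = (2 - delta (c 1)) + 2 * a 0"
    using delta_le_2[of "c 1"] by linarith
  have "star_dual (idx (Suc d) a c) k = star_dual (c 1 # idx d a' c') k / odd_real k ^ (2 * a 0)"
    by (simp add: idx_Suc star_dual_replicate_2 a'_def c'_def del: star_dual.simps)
  also have "\<dots> = (-1) ^ (k * delta (c 1)) / odd_real k ^ (2 * a 0 + 2 - delta (c 1))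
      * (\<Sum>q=1..k. Vsharp k q (replicate (c 1 - 3) 1)
         * ((-1) ^ (q * delta (c 1)) / odd_real q ^ (1 - delta (c 1)) * star_dual (idx d a' c') q))"
    unfolding star_dual_Cons_eq_Vsharp[OF c1] e power_add by simp
  also have "(\<Sum>q=1..k. Vsharp k q (replicate (c 1 - 3) 1)
         * ((-1) ^ (q * delta (c 1)) / odd_real q ^ (1 - delta (c 1)) * star_dual (idx d a' c') q))
      = chain_sum (Suc d) (\<lambda>i. summand (a (Suc i)) (cx (Suc d) c (Suc i)) (cx (Suc d) c (Suc (Suc i)))) k k"
    unfolding chain_sum.simps IH cx1 cx_Suc_Suc summand_split[OF c1(1)]
    by (intro sum.cong refl) (simp add: a'_def c'_def mult.assoc)
  finally show ?case by (simp only: cx1 One_nat_def)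
qed

section \<open>Growth bounds in harmonic numbers\<close>

lemma sum_inverse_odd_real_le_harm: "(\<Sum>j=1..k. 1 / odd_real j) \<le> harm k"
  unfolding harm_def
  by (intro sum_mono) (simp add: odd_real_def field_simps)

lemma harm_ge_1: "1 \<le> k \<Longrightarrow> (1::real) \<le> harm k"
  using harm_mono[of 1 k] by (simp add: harm_def)

text \<open>H_j^p is at most H_k^p, and the remaining sum of 1 / (2 j - 1) contributes one more
  H_k.\<close>

lemma abs_weighted_sum_le_harm:
  fixes f w :: "nat \<Rightarrow> real"
  assumes "\<And>j. 1 \<le> j \<Longrightarrow> \<bar>f j\<bar> \<le> C * harm j ^ p / odd_real j" and "\<And>j. \<bar>w j\<bar> \<le> 2"
  shows "\<bar>\<Sum>j=1..k. w j * f j\<bar> \<le> 2 * C * harm k ^ Suc p"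
proof -
  \<comment> \<open>At j = 1 both \<open>harm j\<close> and \<open>odd_real j\<close> are 1.\<close>
  have "0 \<le> C" using assms(1)[of 1] by (simp add: harm_def odd_real_def)
  have "\<bar>\<Sum>j=1..k. w j * f j\<bar> \<le> (\<Sum>j=1..k. 2 * C * harm k ^ p * (1 / odd_real j))"
  proof (rule order_trans[OF sum_abs], rule sum_mono)
    fix j assume j: "j \<in> {1..k}"
    have "\<bar>f j\<bar> \<le> C * harm j ^ p / odd_real j" using assms(1) j by simp
    also have "\<dots> \<le> C * harm k ^ p / odd_real j"
      using j \<open>0 \<le> C\<close> odd_real_pos[of j]
      by (intro divide_right_mono mult_left_mono power_mono harm_mono harm_nonneg) auto
    finally have "\<bar>w j\<bar> * \<bar>f j\<bar> \<le> 2 * (C * harm k ^ p / odd_real j)"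
      using assms(2) by (intro mult_mono) auto
    then show "\<bar>w j * f j\<bar> \<le> 2 * C * harm k ^ p * (1 / odd_real j)"
      by (simp add: abs_mult)
  qed
  also have "\<dots> \<le> 2 * C * harm k ^ p * harm k"
    unfolding sum_distrib_left[symmetric] using \<open>0 \<le> C\<close>
    by (intro mult_left_mono sum_inverse_odd_real_le_harm mult_nonneg_nonneg zero_le_power harm_nonneg) auto
  finally show ?thesis by (simp add: mult_ac)
qed

lemma half_sum_bound:
  assumes "\<And>j. 1 \<le> j \<Longrightarrow> \<bar>f j\<bar> \<le> C * harm j ^ p / odd_real j" "1 \<le> k"
  shows "\<bar>half_sum f k\<bar> \<le> 2 * C * harm k ^ Suc p / odd_real k"
proof -
  have "\<bar>\<Sum>j=1..k. 2 ^ tri k j * f j\<bar> \<le> 2 * C * harm k ^ Suc p"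
    by (rule abs_weighted_sum_le_harm[OF assms(1)]) (auto simp: tri_def)
  then show ?thesis
    using odd_real_pos[OF assms(2)] by (simp add: half_sum_def abs_divide divide_right_mono)
qed

lemma half_sum_funpow_bound:
  assumes "\<And>j. 1 \<le> j \<Longrightarrow> \<bar>f j\<bar> \<le> C * harm j ^ p / odd_real j" "1 \<le> k"
  shows "\<bar>(half_sum ^^ r) f k\<bar> \<le> 2 ^ r * C * harm k ^ (p + r) / odd_real k"
  using assms(2)
proof (induction r arbitrary: k)
  case 0
  then show ?case using assms(1) by simp
next
  case (Suc r)
  from half_sum_bound[OF Suc.IH Suc.prems] show ?case by (simp add: mult_ac)
qed

lemma alt_sum_bound:
  assumes "\<And>j. 1 \<le> j \<Longrightarrow> \<bar>f j\<bar> \<le> C * harm j ^ p" "1 \<le> k"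
  shows "\<bar>alt_sum f k\<bar> \<le> 2 * C * harm k ^ Suc p"
proof -
  have "\<bar>\<Sum>j=1..k. ((-1) ^ (k + j) * 2 ^ tri k j) * (f j / odd_real j)\<bar> \<le> 2 * C * harm k ^ Suc p"
  proof (rule abs_weighted_sum_le_harm)
    show "\<bar>f j / odd_real j\<bar> \<le> C * harm j ^ p / odd_real j" if "1 \<le> j" for j
      using assms(1)[OF that] odd_real_pos[OF that] by (simp add: divide_right_mono)
  qed (auto simp: tri_def abs_mult)
  then show ?thesis by (simp add: alt_sum_def)
qed

text \<open>Only one of the two factors 1 / (2 j - 1) is kept, as \<open>half_sum_bound\<close>
  preserves just one.\<close>

lemma divide_square_bound:
  assumes "\<And>j. 1 \<le> j \<Longrightarrow> \<bar>f j\<bar> \<le> C * harm j ^ p" "1 \<le> j"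
  shows "\<bar>f j / (odd_real j)\<^sup>2\<bar> \<le> C * harm j ^ p / odd_real j"
proof -
  have "\<bar>f j / (odd_real j)\<^sup>2\<bar> = \<bar>f j\<bar> / (odd_real j)\<^sup>2"
    by (simp add: abs_divide)
  also have "\<dots> \<le> \<bar>f j\<bar> / odd_real j"
    using odd_real_ge_1[OF assms(2)] by (intro divide_left_mono) (auto simp: power2_eq_square)
  also have "\<dots> \<le> C * harm j ^ p / odd_real j"
    using assms odd_real_pos[of j] by (intro divide_right_mono) auto
  finally show ?thesis .
qed

text \<open>This is where admissibility enters: a leading entry c >= 2 gains the factor 1 / (2 k -
  1) that \<open>alt_sum_bound\<close> does not provide.\<close>

lemma star_dual_Cons_bound:
  assumes "\<And>k. 1 \<le> k \<Longrightarrow> \<bar>star_dual s k\<bar> \<le> C * harm k ^ p" "2 \<le> c" "1 \<le> k"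
  shows "\<bar>star_dual (c # s) k\<bar> \<le> 2 ^ (c - 2) * C * harm k ^ (p + (c - 2)) / odd_real k"
  using half_sum_funpow_bound[OF divide_square_bound[OF assms(1)] assms(3), of "c - 2"] assms(2)
  by simp

lemma star_dual_bound:
  assumes "\<forall>c\<in>set s. 1 \<le> c"
  shows "\<exists>C p. \<forall>k\<ge>1. \<bar>star_dual s k\<bar> \<le> C * harm k ^ p"
  using assms
proof (induction s)
  case Nil
  show ?case by (rule exI[of _ 1], rule exI[of _ 0]) simp
next
  case (Cons c s)
  then obtain C p where Cp: "\<And>k. 1 \<le> k \<Longrightarrow> \<bar>star_dual s k\<bar> \<le> C * harm k ^ p" by auto
  show ?case
  proof (cases "c = 1")
    case True
    then have "\<bar>star_dual (c # s) k\<bar> \<le> 2 * C * harm k ^ Suc p" if "1 \<le> k" for k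
      using alt_sum_bound[OF Cp that] by simp
    then show ?thesis by blast
  next
    case False
    then have "2 \<le> c" using Cons.prems by auto
    define D q where "D = 2 ^ (c - 2) * C" and "q = p + (c - 2)"
    have b: "\<bar>star_dual (c # s) k\<bar> \<le> D * harm k ^ q / odd_real k" if "1 \<le> k" for k
      unfolding D_def q_def using Cp \<open>2 \<le> c\<close> that by (rule star_dual_Cons_bound)
    have "0 \<le> D" using b[of 1] by (simp add: harm_def odd_real_def)
    have "\<bar>star_dual (c # s) k\<bar> \<le> D * harm k ^ q" if "1 \<le> k" for k
    proof (rule order_trans[OF b[OF that]])
      have "D * harm k ^ q / odd_real k \<le> D * harm k ^ q / 1"
        using odd_real_ge_1[OF that] \<open>0 \<le> D\<close> by (intro divide_left_mono) (auto simp: harm_nonneg)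
      then show "D * harm k ^ q / odd_real k \<le> D * harm k ^ q" by simp
    qed
    then show ?thesis by blast
  qed
qed

text \<open>The difference of \<open>harm k\<close> and ln k decreases from its value 1 at k =
  1.\<close>

lemma harm_le_1_plus_ln: "1 \<le> k \<Longrightarrow> harm k \<le> 1 + ln (real k)"
  using decseqD[OF decseq_harm_diff_ln, of 0 "k - 1"] by (simp add: harm_def)

lemma harm_power_le_sqrt:
  assumes "1 \<le> k"
  shows "harm k ^ p \<le> (1 + 2 * real (Suc p)) ^ Suc p * real k powr (1/2)"
proof -
  \<comment> \<open>\<open>Suc p\<close> factors k^e give exactly k^(1/2); using
    \<open>Suc p\<close> in place of p keeps e positive at p = 0.\<close>
  define e where "e = 1 / (2 * real (Suc p))"
  have e: "0 < e" by (simp add: e_def)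
  have k: "1 \<le> real k" using assms by simp
  have "1 \<le> real k powr e" using k e by (simp add: ge_one_powr_ge_zero)
  moreover have "ln (real k) \<le> real k powr e / e" by (rule ln_powr_bound[OF k e])
  ultimately have "harm k \<le> (1 + 1 / e) * real k powr e"
    using harm_le_1_plus_ln[OF assms] by (simp add: algebra_simps)
  then have "harm k ^ Suc p \<le> ((1 + 1 / e) * real k powr e) ^ Suc p"
    by (intro power_mono harm_nonneg)
  also have "\<dots> = (1 + 1 / e) ^ Suc p * (real k powr e) ^ Suc p"
    by (rule power_mult_distrib)
  also have "(real k powr e) ^ Suc p = real k powr (real (Suc p) * e)"
    using k by (metis powr_power not_one_le_zero)
  also have "real (Suc p) * e = 1 / 2" by (simp add: e_def)
  also have "1 / e = 2 * real (Suc p)" by (simp add: e_def)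
  finally have "harm k ^ Suc p \<le> (1 + 2 * real (Suc p)) ^ Suc p * real k powr (1/2)" .
  moreover have "harm k ^ p \<le> (harm k ^ Suc p :: real)"
    using harm_ge_1[OF assms] by (intro power_increasing) auto
  ultimately show ?thesis by linarith
qed

lemma summable_harm_power: "summable (\<lambda>k. harm (Suc k) ^ p / (odd_real (Suc k))\<^sup>2)"
proof (rule summable_comparison_test'[where N = 0])
  define D where "D = (1 + 2 * real (Suc p)) ^ Suc p"
  have "summable (\<lambda>k. real k powr (-(3/2)))" by (simp add: summable_real_powr_iff)
  then have "summable (\<lambda>k. real (Suc k) powr (-(3/2)))" by (subst summable_Suc_iff)
  then show "summable (\<lambda>k. D * real (Suc k) powr (-(3/2)))" by (rule summable_mult)
  fix k :: nat
  have "harm (Suc k) ^ p / (odd_real (Suc k))\<^sup>2 \<le> (D * real (Suc k) powr (1/2)) / (real (Suc k))\<^sup>2"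
    unfolding D_def using odd_real_ge[of "Suc k"]
    by (intro frac_le harm_power_le_sqrt power_mono) auto
  also have "\<dots> = D * (real (Suc k) powr (1/2) / real (Suc k) powr 2)"
    by (simp add: powr_numeral)
  also have "\<dots> = D * real (Suc k) powr (-(3/2))"
    by (subst powr_diff[symmetric]) simp
  finally show "norm (harm (Suc k) ^ p / (odd_real (Suc k))\<^sup>2) \<le> D * real (Suc k) powr (-(3/2))"
    by (simp add: harm_nonneg)
qed

section \<open>Limits of the coefficients and of the transform\<close>

text \<open>Up to 4 n / (2 n + 1), the first weight is the reciprocal of the partial Wallis
  product.\<close>

lemma pf_weight_1_wallis:
  assumes "1 \<le> n"
  shows "pf_weight n 1 * (\<Prod>k=1..n. (4 * (real k)\<^sup>2) / (4 * (real k)\<^sup>2 - 1)) * (2 * real n + 1) = 4 * real n"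
  using assms
proof (induction n rule: dec_induct)
  case base
  show ?case by (simp add: pf_weight_def odd_real_def power2_eq_square)
next
  case (step n)
  define P where "P = (\<Prod>k=1..n. (4 * (real k)\<^sup>2) / (4 * (real k)\<^sup>2 - 1))"
  have n: "real n > 0" using step by simp
  have "pf_weight (Suc n) 1 * ((odd_real (Suc n))\<^sup>2 - (odd_real 1)\<^sup>2)
         = pf_weight n 1 * (odd_real (Suc n))\<^sup>2"
    using step by (intro pf_weight_Suc_left) auto
  then have w: "pf_weight (Suc n) 1 * (4 * real n * (real n + 1)) = pf_weight n 1 * (2 * real n + 1)\<^sup>2"
    by (simp add: odd_real_def power2_eq_square algebra_simps)
  have q: "(4 * (real (Suc n))\<^sup>2) / (4 * (real (Suc n))\<^sup>2 - 1) * (2 * real (Suc n) + 1)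
      = 4 * (real n + 1)\<^sup>2 / (2 * real n + 1)"
  proof -
    have "4 * (real (Suc n))\<^sup>2 - 1 = (2 * real n + 1) * (2 * real (Suc n) + 1)"
      by (simp add: power2_eq_square algebra_simps)
    moreover have "2 * real (Suc n) + 1 \<noteq> 0" by linarith
    ultimately show ?thesis by (simp add: add.commute)
  qed
  have "pf_weight (Suc n) 1 * (\<Prod>k=1..Suc n. (4 * (real k)\<^sup>2) / (4 * (real k)\<^sup>2 - 1)) * (2 * real (Suc n) + 1)
      = pf_weight (Suc n) 1 * P * (4 * (real n + 1)\<^sup>2 / (2 * real n + 1))"
    by (simp only: q[symmetric]) (simp add: P_def mult_ac)
  also have "\<dots> = (pf_weight (Suc n) 1 * (4 * real n * (real n + 1))) * P * (real n + 1) / (real n * (2 * real n + 1))"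
    using n by (simp add: power2_eq_square)
  also have "\<dots> = (pf_weight n 1 * P * (2 * real n + 1)) * (real n + 1) / real n"
  proof -
    have "2 * real n + 1 \<noteq> 0" using n by linarith
    then show ?thesis unfolding w by (simp add: power2_eq_square)
  qed
  also have "\<dots> = 4 * real (Suc n)"
    using step.IH n unfolding P_def[symmetric] by simp
  finally show ?case .
qed

text \<open>Wallis gives 4 (1/2) / (pi/2) for k = 1; each step in k multiplies by (n - k) / (n + k),
  which tends to 1.\<close>

lemma pf_weight_LIMSEQ:
  assumes "1 \<le> k"
  shows "(\<lambda>n. pf_weight n k) \<longlonglongrightarrow> 4 / pi"
  using assms
proof (induction k rule: dec_induct)
  case base
  define P where "P = (\<lambda>n. \<Prod>k=1..n. (4 * (real k)\<^sup>2) / (4 * (real k)\<^sup>2 - 1))"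
  have P: "P \<longlonglongrightarrow> pi / 2" unfolding P_def by (rule wallis)
  have "(\<lambda>n. real n / (2 * real n + 1)) \<longlonglongrightarrow> 1 / 2" by real_asymp
  from tendsto_divide[OF tendsto_mult[OF tendsto_const[of 4] this] P]
  have "(\<lambda>n. 4 * (real n / (2 * real n + 1)) / P n) \<longlonglongrightarrow> 4 / pi" by simp
  moreover have "eventually (\<lambda>n. 4 * (real n / (2 * real n + 1)) / P n = pf_weight n 1) sequentially"
    using eventually_ge_at_top[of 1] order_tendstoD(1)[OF P, of 0, simplified]
  proof eventually_elim
    case (elim n)
    have "pf_weight n 1 * P n * (2 * real n + 1) = 4 * real n"
      unfolding P_def by (rule pf_weight_1_wallis[OF elim(1)])
    then have "4 * (real n / (2 * real n + 1)) = pf_weight n 1 * P n"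
      by (simp add: divide_eq_eq)
    then show ?case using elim(2) by simp
  qed
  ultimately show ?case by (simp add: tendsto_cong)
next
  case (step k)
  have "(\<lambda>n. pf_weight n k * ((real n - real k) / (real n + real k))) \<longlonglongrightarrow> 4 / pi * 1"
    by (intro tendsto_mult step.IH) real_asymp
  moreover have "eventually (\<lambda>n. pf_weight n k * ((real n - real k) / (real n + real k)) = pf_weight n (Suc k)) sequentially"
    using eventually_gt_at_top[of k]
  proof eventually_elim
    case (elim n)
    then show ?case using pf_weight_Suc_right[of k n] by (simp add: field_simps)
  qed
  ultimately show ?case by (simp add: tendsto_cong)
qed

text \<open>By \<open>pf_weight_Suc_left\<close> the weights increase with n, so they stay below
  their limit.\<close>

lemma pf_weight_le:
  assumes "1 \<le> k" "k \<le> n"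
  shows "pf_weight n k \<le> 4 / pi"
proof -
  have Suc: "pf_weight m k \<le> pf_weight (Suc m) k" if "k \<le> m" for m
  proof -
    have "0 < odd_real (Suc m)" by (simp add: odd_real_def)
    have "pf_weight m k * (odd_real (Suc m))\<^sup>2 \<le> pf_weight (Suc m) k * (odd_real (Suc m))\<^sup>2"
      unfolding pf_weight_Suc_left[OF assms(1) that, symmetric]
      by (intro mult_left_mono pf_weight_nonneg) simp
    then show ?thesis using \<open>0 < odd_real (Suc m)\<close> by simp
  qed
  have "pf_weight n k \<le> pf_weight m k" if "n \<le> m" for m
    using that
  proof (induction m rule: dec_induct)
    case (step m)
    then show ?case using Suc[of m] assms by linarith
  qed simp
  then show ?thesis by (intro LIMSEQ_le_const[OF pf_weight_LIMSEQ[OF assms(1)]]) blast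
qed

lemma pf_sum_LIMSEQ:
  assumes "\<And>k. 1 \<le> k \<Longrightarrow> \<bar>f k\<bar> \<le> C * harm k ^ p / odd_real k"
  shows "\<exists>L. pf_sum f \<longlonglongrightarrow> L \<and> (\<lambda>N. \<Sum>k=1..N. 4 / pi * (-1) ^ (k + 1) / odd_real k * f k) \<longlonglongrightarrow> L"
proof -
  \<comment> \<open>The cutoff is explicit because \<open>pf_coeff n k\<close> does not vanish for k
    > n; indices are shifted to start at 0.\<close>
  define u where "u = (\<lambda>k n. if k < n then pf_coeff n (Suc k) * f (Suc k) else 0)"
  define v where "v = (\<lambda>k. 4 / pi * (-1) ^ (Suc k + 1) / odd_real (Suc k) * f (Suc k))"
  \<comment> \<open>The majorant: 4 / pi bounds the weight, one factor 1 / (2 k - 1) comes from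
    \<open>pf_coeff\<close> and one from the bound on f.\<close>
  define B where "B = (\<lambda>k. 4 / pi * C * (harm (Suc k) ^ p / (odd_real (Suc k))\<^sup>2))"
  have u_lim: "(\<lambda>n. u k n) \<longlonglongrightarrow> v k" for k
  proof -
    have "(\<lambda>n. (-1) ^ (Suc k + 1) * pf_weight n (Suc k) / odd_real (Suc k) * f (Suc k)) \<longlonglongrightarrow>
        (-1) ^ (Suc k + 1) * (4 / pi) / odd_real (Suc k) * f (Suc k)"
      by (intro tendsto_intros pf_weight_LIMSEQ) auto
    moreover have "eventually (\<lambda>n. (-1) ^ (Suc k + 1) * pf_weight n (Suc k) / odd_real (Suc k) * f (Suc k) = u k n) sequentially"
      using eventually_gt_at_top[of k] by eventually_elim (simp add: u_def pf_coeff_def)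
    ultimately have "(\<lambda>n. u k n) \<longlonglongrightarrow> (-1) ^ (Suc k + 1) * (4 / pi) / odd_real (Suc k) * f (Suc k)"
      by (rule Lim_transform_eventually)
    then show ?thesis by (simp add: v_def mult_ac)
  qed
  have C: "0 \<le> C" using assms[of 1] by (simp add: harm_def odd_real_def)
  have u_le: "norm (u k n) \<le> B k" for k n
  proof (cases "k < n")
    case True
    have x: "0 < odd_real (Suc k)" by (simp add: odd_real_def)
    have "norm (u k n) = pf_weight n (Suc k) / odd_real (Suc k) * \<bar>f (Suc k)\<bar>"
      using True x pf_weight_nonneg[of n "Suc k"] by (simp add: u_def pf_coeff_def abs_mult)
    also have "\<dots> \<le> (4 / pi) / odd_real (Suc k) * (C * harm (Suc k) ^ p / odd_real (Suc k))"
      using True x assms[of "Suc k"] pf_weight_le[of "Suc k" n]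
      by (intro mult_mono divide_right_mono) auto
    also have "\<dots> = B k" by (simp add: B_def power2_eq_square)
    finally show ?thesis .
  next
    case False
    then show ?thesis using C by (simp add: u_def B_def harm_nonneg)
  qed
  have "summable B" unfolding B_def by (intro summable_mult summable_harm_power)
  from tannerys_theorem[OF u_lim always_eventually this] u_le
  have sv: "summable (\<lambda>k. norm (v k))" and lim: "(\<lambda>n. \<Sum>k. u k n) \<longlonglongrightarrow> suminf v"
    by auto
  have "(\<Sum>k. u k n) = pf_sum f n" for n
  proof -
    have "(\<Sum>k. u k n) = (\<Sum>k<n. u k n)"
      by (rule suminf_finite) (auto simp: u_def)
    also have "\<dots> = pf_sum f n"
      by (simp add: pf_sum_def u_def sum.atLeast1_atMost_eq)
    finally show ?thesis .
  qed
  with lim have "pf_sum f \<longlonglongrightarrow> suminf v" by simp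
  moreover have "(\<lambda>N. \<Sum>k<N. v k) \<longlonglongrightarrow> suminf v"
    by (rule summable_LIMSEQ[OF summable_norm_cancel[OF sv]])
  then have "(\<lambda>N. \<Sum>k=1..N. 4 / pi * (-1) ^ (k + 1) / odd_real k * f k) \<longlonglongrightarrow> suminf v"
    by (simp add: v_def sum.atLeast1_atMost_eq)
  ultimately show ?thesis by blast
qed

text \<open>The empty index needs its own argument: its dual function is the constant 1 and the
  series converges only conditionally.\<close>

lemma leibniz_LIMSEQ: "(\<lambda>N. \<Sum>k=1..N. 4 / pi * (-1) ^ (k + 1) / odd_real k) \<longlonglongrightarrow> 1"
proof -
  have "summable (\<lambda>k. (-1) ^ k * 1 / real (k * 2 + 1) :: real)"
    using summable_arctan_series[of 1] by simp
  then have "(\<lambda>k. (-1) ^ k * 1 / real (k * 2 + 1) :: real) sums (pi / 4)"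
    unfolding pi_series by (rule summable_sums)
  from sums_mult[OF this, of "4 / pi"]
  have "(\<lambda>N. \<Sum>k<N. 4 / pi * ((-1) ^ k * 1 / real (k * 2 + 1))) \<longlonglongrightarrow> 1"
    by (simp add: sums_def)
  then show ?thesis
    by (simp add: sum.atLeast1_atMost_eq odd_real_def algebra_simps)
qed

section \<open>The star value as a limit, and the theorem\<close>

text \<open>The terms are nonnegative with bounded finite sums, hence summable, and the chains in
  {1..n} eventually contain every finite set of chains, so the unordered sum is the limit along
  them.\<close>

lemma t_star_eqI:
  assumes lim: "t_trunc s \<longlonglongrightarrow> L"
  shows "t_star s = L"
proof -
  define f where "f = (\<lambda>ks. \<Prod>j<length s. 1 / (2 * real (ks ! j) - 1) ^ (s ! j))"
  define X where "X = chains (length s) {1..}"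
  have sum_f: "sum f (chains (length s) {1..n}) = t_trunc s n" for n
    unfolding f_def by (rule sum_chains_eq_t_trunc)
  have nonneg: "0 \<le> f ks" if "ks \<in> X" for ks
  proof -
    have "1 \<le> ks ! j" if "j < length s" for j
      using \<open>ks \<in> X\<close> that by (auto simp: X_def chains_def dest!: subsetD[OF _ nth_mem])
    then have "0 \<le> 2 * real (ks ! j) - 1" if "j < length s" for j
      using that by (metis odd_real_def odd_real_pos less_imp_le)
    then show ?thesis unfolding f_def by (intro prod_nonneg) simp
  qed
  have mono: "chains (length s) {1..m} \<subseteq> chains (length s) {1..n}" if "m \<le> n" for m n :: nat
    using that by (auto simp: chains_def)
  have sub: "chains (length s) {1..n} \<subseteq> X" for n
    by (auto simp: chains_def X_def)
  have exhaust: "\<exists>n. Y \<subseteq> chains (length s) {1..n}" if "finite Y" "Y \<subseteq> X" for Y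
    using that
  proof (induction Y rule: finite_induct)
    case (insert ks Y)
    then obtain n where n: "Y \<subseteq> chains (length s) {1..n}" by auto
    define m where "m = Max (insert n (set ks))"
    have "ks \<in> chains (length s) {1..m}"
      using insert.prems by (auto simp: X_def chains_def m_def)
    moreover have "n \<le> m" by (simp add: m_def)
    ultimately show ?case using n mono[of n m] by blast
  qed simp
  obtain K where K: "\<And>n. norm (t_trunc s n) \<le> K"
    using Bseq_def convergentI[OF lim] convergent_imp_Bseq by blast
  have "f summable_on X"
  proof (rule nonneg_bdd_above_summable_on[OF nonneg], assumption, rule bdd_aboveI2)
    fix Y assume "Y \<in> {F. F \<subseteq> X \<and> finite F}"
    then obtain n where "Y \<subseteq> chains (length s) {1..n}" using exhaust by blast
    then have "sum f Y \<le> t_trunc s n"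
      unfolding sum_f[symmetric] using nonneg sub by (intro sum_mono2 finite_chains) auto
    then show "sum f Y \<le> K" using K[of n] by simp
  qed
  then have "(sum f \<longlongrightarrow> infsum f X) (finite_subsets_at_top X)"
    using has_sum_def has_sum_infsum by blast
  moreover have "filterlim (\<lambda>n. chains (length s) {1..n}) (finite_subsets_at_top X) sequentially"
    unfolding filterlim_finite_subsets_at_top
  proof (intro allI impI)
    fix Y assume "finite Y \<and> Y \<subseteq> X"
    then obtain n where n: "Y \<subseteq> chains (length s) {1..n}" using exhaust by blast
    show "\<forall>\<^sub>F m in sequentially. finite (chains (length s) {1..m}) \<and>
            Y \<subseteq> chains (length s) {1..m} \<and> chains (length s) {1..m} \<subseteq> X"
      using eventually_ge_at_top[of n] by eventually_elim (use n mono sub finite_chains in blast)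
  qed
  ultimately have "(\<lambda>n. sum f (chains (length s) {1..n})) \<longlonglongrightarrow> infsum f X"
    by (rule filterlim_compose)
  then have "t_trunc s \<longlonglongrightarrow> infsum f X" by (simp only: sum_f)
  then have "infsum f X = L" using lim LIMSEQ_unique by blast
  then show ?thesis by (simp add: t_star_def f_def X_def)
qed

lemma star_dual_series_LIMSEQ:
  assumes pos: "\<forall>c\<in>set s. 1 \<le> c" and hd: "s \<noteq> [] \<Longrightarrow> 2 \<le> hd s"
  shows "(\<lambda>N. \<Sum>k=1..N. 4 / pi * (-1) ^ (k + 1) / odd_real k * star_dual s k) \<longlonglongrightarrow> t_star s"
proof (cases "s = []")
  case True
  have "t_star s = 1" by (rule t_star_eqI) (simp add: True tendsto_eventually)
  then show ?thesis using leibniz_LIMSEQ True by simp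
next
  case False
  then obtain c r where s: "s = c # r" by (cases s) auto
  then have "2 \<le> c" and "\<forall>c\<in>set r. 1 \<le> c" using pos hd by auto
  from star_dual_bound[OF this(2)] obtain C p
    where "\<And>k. 1 \<le> k \<Longrightarrow> \<bar>star_dual r k\<bar> \<le> C * harm k ^ p" by blast
  from pf_sum_LIMSEQ[OF star_dual_Cons_bound[OF this \<open>2 \<le> c\<close>], folded s] obtain L where L: "pf_sum (star_dual s) \<longlonglongrightarrow> L"
    "(\<lambda>N. \<Sum>k=1..N. 4 / pi * (-1) ^ (k + 1) / odd_real k * star_dual s k) \<longlonglongrightarrow> L" by blast
  have "eventually (\<lambda>n. pf_sum (star_dual s) n = t_trunc s n) sequentially"
    using eventually_ge_at_top[of 1] by eventually_elim (simp add: t_trunc_eq_pf_sum[OF pos])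
  then have "t_trunc s \<longlonglongrightarrow> L" using L(1) by (rule Lim_transform_eventually[rotated])
  then have "t_star s = L" by (rule t_star_eqI)
  then show ?thesis using L(2) by simp
qed

lemma set_idx: "set (idx d a c) \<subseteq> insert 2 (c ` {1..d})"
  by (auto simp: idx_def)

lemma hd_idx:
  assumes "a 0 = 0 \<and> d \<ge> 1 \<longrightarrow> c 1 \<ge> 3" "idx d a c \<noteq> []"
  shows "2 \<le> hd (idx d a c)"
proof (cases "a 0")
  case 0
  with assms obtain e where "d = Suc e" by (cases d) (auto simp: idx_def)
  then show ?thesis using assms 0 by (simp add: idx_Suc)
next
  case (Suc b)
  then show ?thesis by (simp add: idx_def)
qed

text \<open>With k_{-1} = 0 the quotient in V has numerator -1, so V is -2 / (2 k - 1). Together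
  with the sign (-1)^k from c_0 = 1 this gives the limit of \<open>pf_coeff\<close>.\<close>

lemma summand_first:
  "2 / pi * summand b 1 c' 0 k
    = 4 / pi * (-1) ^ (k + 1) / odd_real k * ((-1) ^ (k * delta c') / odd_real k ^ (2 * b + 2 - delta c'))"
  if "1 \<le> k"
proof -
  have "Vsharp 0 k [] = - (2 / odd_real k)"
    using that by (simp add: Vsharp_def tri_def odd_real_def)
  then show ?thesis by (simp add: summand_split delta_def)
qed

text \<open>The series is read as a limit over k_0 <= N, since for d = 0 and a_0 = 0 it is not
  absolutely convergent.\<close>

theorem theorem3p3:
  fixes d :: nat and a c :: "nat \<Rightarrow> nat"
  assumes "\<forall>i\<in>{1..d}. c i \<ge> 1 \<and> c i \<noteq> 2"
    and "a 0 = 0 \<and> d \<ge> 1 \<longrightarrow> c 1 \<ge> 3"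
  shows "(\<lambda>N. 2 / pi *
           (\<Sum>ks\<in>chains (d + 1) {1..N}.
              \<Prod>i\<le>d.
                let dl = delta (cx d c i) + delta (cx d c (Suc i));
                    kprev = (if i = 0 then 0 else ks ! (i - 1))
                in (-1) ^ (ks ! i * dl) / (2 * real (ks ! i) - 1) ^ (2 * a i + 3 - dl)
                   * Vsharp kprev (ks ! i) (replicate (cx d c i - 3) 1)))
         \<longlonglongrightarrow> t_star (idx d a c)"
proof -
  define h where "h = (\<lambda>i. summand (a i) (cx d c i) (cx d c (Suc i)))"
  have cx0: "cx d c 0 = 1" by (simp add: cx_def)
  \<comment> \<open>Prefixing 0 to \<open>ks\<close> makes the i-th entry k_{i-1}, including k_{-1}
    = 0.\<close>
  have "(\<Prod>i\<le>d. let dl = delta (cx d c i) + delta (cx d c (Suc i));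
                    kprev = (if i = 0 then 0 else ks ! (i - 1))
                in (-1) ^ (ks ! i * dl) / (2 * real (ks ! i) - 1) ^ (2 * a i + 3 - dl)
                   * Vsharp kprev (ks ! i) (replicate (cx d c i - 3) 1))
      = (\<Prod>i<d + 1. h i ((0 # ks) ! i) (ks ! i))" for ks
    by (intro prod.cong) (auto simp: h_def summand_def odd_real_def nth_Cons' Let_def)
  then have "2 / pi * (\<Sum>ks\<in>chains (d + 1) {1..N}. \<Prod>i\<le>d.
                let dl = delta (cx d c i) + delta (cx d c (Suc i));
                    kprev = (if i = 0 then 0 else ks ! (i - 1))
                in (-1) ^ (ks ! i * dl) / (2 * real (ks ! i) - 1) ^ (2 * a i + 3 - dl)
                   * Vsharp kprev (ks ! i) (replicate (cx d c i - 3) 1))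
      = 2 / pi * chain_sum (Suc d) h 0 N" for N
    by (simp only: sum_chains_eq_chain_sum) simp
  moreover have "2 / pi * chain_sum (Suc d) h 0 N
      = (\<Sum>k=1..N. 4 / pi * (-1) ^ (k + 1) / odd_real k * star_dual (idx d a c) k)" for N
  proof -
    have "2 / pi * chain_sum (Suc d) h 0 N
        = (\<Sum>k=1..N. (2 / pi * h 0 0 k) * chain_sum d (\<lambda>i. h (Suc i)) k k)"
      by (simp add: sum_distrib_left mult.assoc)
    also have "\<dots> = (\<Sum>k=1..N. 4 / pi * (-1) ^ (k + 1) / odd_real k * star_dual (idx d a c) k)"
    proof (intro sum.cong refl)
      fix k assume "k \<in> {1..N}"
      then have "1 \<le> k" by simp
      from summand_first[OF this]
      have "2 / pi * h 0 0 k = 4 / pi * (-1) ^ (k + 1) / odd_real k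
          * ((-1) ^ (k * delta (cx d c 1)) / odd_real k ^ (2 * a 0 + 2 - delta (cx d c 1)))"
        unfolding h_def cx0 One_nat_def .
      then show "(2 / pi * h 0 0 k) * chain_sum d (\<lambda>i. h (Suc i)) k k
          = 4 / pi * (-1) ^ (k + 1) / odd_real k * star_dual (idx d a c) k"
        unfolding star_dual_idx[OF assms(1)] by (simp only: h_def mult.assoc)
    qed
    finally show ?thesis .
  qed
  moreover have "\<forall>e\<in>set (idx d a c). 1 \<le> e"
    using set_idx[of d a c] assms(1) by fastforce
  ultimately show ?thesis
    using star_dual_series_LIMSEQ[of "idx d a c"] hd_idx[of a d c] assms(2) by simp
qed

end
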